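(* Let $s,t$ be positive integers and let $K_{s,t}$ be the complete bipartite graph with parts of sizes $s$ and $t$. Then $$\mathrm{vol}(K_{s,t})=\frac{1}{\binom{s+t}{s}}.$$
   Context: For a finite simple graph $G=(VG,EG)$, the graph polytope is $P(G)=\{x\in[0,1]^{VG} : x_i+x_j\le 1 \text{ for every edge } ij\in EG\}$, and $\mathrm{vol}(G)$ denotes the $|VG|$-dimensional volume (Lebesgue measure) of $P(G)$. $K_{s,t}$ has vertex set the disjoint union of a set of $s$ vertices and a set of $t$ vertices, with every vertex of the first set adjacent to every vertex of the second, and no other edges. *)

theory Defs
  imports "HOL-Analysis.Analysis" "Graph_Theory.Kuratowski"
begin

text \<open>
  A finite simple graph is an instance of the AFP locale \<^locale>\<open>graph\<close>: a finite symmetric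
  digraph without loops and parallel arcs, where the edge \<open>uv\<close> is present as the two pairs
  \<open>(u, v)\<close> and \<open>(v, u)\<close> of \<^const>\<open>arcs_ends\<close>.

  The space \<open>\<real>\<^sup>V\<close>, for \<open>V\<close> the vertex set, is \<^term>\<open>PiE V (\<lambda>_. UNIV)\<close>: functions that are
  \<^const>\<open>undefined\<close> outside \<open>V\<close>. This is the space of the product measure \<^const>\<open>Pi\<^sub>M\<close>.
\<close>

definition graph_polytope :: "('a, 'b) pre_digraph \<Rightarrow> ('a \<Rightarrow> real) set" where
  "graph_polytope G =
     {x \<in> verts G \<rightarrow>\<^sub>E {0..1}. \<forall>(u, v) \<in> arcs_ends G. x u + x v \<le> 1}"

definition graph_vol :: "('a, 'b) pre_digraph \<Rightarrow> real" where
  "graph_vol G = measure (Pi\<^sub>M (verts G) (\<lambda>_. lborel)) (graph_polytope G)"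

text \<open>
  The polytope is Borel, so the use of the product of \<^const>\<open>lborel\<close> instead of its completion
  makes no difference and \<^const>\<open>measure\<close> does not return a default value.
\<close>

lemma graph_polytope_measurable:
  assumes "graph G"
  shows "graph_polytope G \<in> sets (Pi\<^sub>M (verts G) (\<lambda>_. lborel))"
proof -
  interpret graph G by fact
  let ?M = "Pi\<^sub>M (verts G) (\<lambda>_. lborel :: real measure)"
  have fin: "finite (arcs_ends G)"
    by (simp add: arcs_ends_def)
  have sub: "u \<in> verts G \<and> v \<in> verts G" if "(u, v) \<in> arcs_ends G" for u v
    using that by (auto simp: arcs_ends_def arc_to_ends_def)
  have box: "(verts G \<rightarrow>\<^sub>E {0..1 :: real}) \<in> sets ?M"
    by (intro sets_PiM_I_finite) auto
  have half: "{x \<in> space ?M. x (fst e) + x (snd e) \<le> 1} \<in> sets ?M"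
    if "e \<in> arcs_ends G" for e
  proof -
    have [measurable]: "fst e \<in> verts G" "snd e \<in> verts G"
      using sub[of "fst e" "snd e"] that by auto
    show ?thesis by measurable
  qed
  have "{x \<in> space ?M. \<forall>e\<in>arcs_ends G. x (fst e) + x (snd e) \<le> 1} \<in> sets ?M"
    using half fin by (intro sets.sets_Collect_finite_All) auto
  moreover have "graph_polytope G =
      (verts G \<rightarrow>\<^sub>E {0..1}) \<inter> {x \<in> space ?M. \<forall>e\<in>arcs_ends G. x (fst e) + x (snd e) \<le> 1}"
    by (auto simp: graph_polytope_def space_PiM PiE_def)
  ultimately show ?thesis using box by simp
qed

text \<open>
  \<^const>\<open>complete_bipartite_digraph\<close> is a predicate, so that \<open>K\<^bsub>s,t\<^esub> G\<close> reads ``\<open>G\<close> is a copy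
  of \<open>K\<^bsub>s,t\<^esub>\<close>''. It is satisfiable for all parameters:
\<close>

lemma complete_bipartite_digraph_exists:
  "\<exists>G :: (nat + nat, (nat + nat) \<times> (nat + nat)) pre_digraph. K\<^bsub>s,t\<^esub> G"
proof
  let ?U = "Inl ` {..<s} :: (nat + nat) set" and ?V = "Inr ` {..<t} :: (nat + nat) set"
  show "K\<^bsub>s,t\<^esub> (with_proj \<lparr>pverts = ?U \<union> ?V, parcs = ?U \<times> ?V \<union> ?V \<times> ?U\<rparr>)"
    unfolding complete_bipartite_digraph_pair_def
    by (intro conjI exI[of _ ?U] exI[of _ ?V]) (auto simp: card_image)
qed

end

theory Submission
  imports Defs
begin

text \<open>
  Fix the coordinates \<open>x\<close> on the first part and let \<open>m\<close> be the largest of them. The admissible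
  coordinates on the second part form the cube \<open>[0, 1 - m]\<^sup>t\<close>, of volume
  \<open>(1 - m)\<^sup>t = \<integral> c \<in> [m, 1]. t (1 - c)\<^bsup>t - 1\<^esup>\<close>. As \<open>m \<le> c\<close> means \<open>x \<in> [0, c]\<^sup>s\<close>, exchanging the integrals
  over \<open>x\<close> and \<open>c\<close> turns the volume into the Beta integral
  \<open>\<integral> c \<in> [0, 1]. t (1 - c)\<^bsup>t - 1\<^esup> c\<^sup>s\<close>.
\<close>

interpretation lborel_prod: product_sigma_finite "\<lambda>_. lborel :: real measure" ..

text \<open>This is the Beta integral at (a + 1, b + 1), with the Gamma values rewritten as
  factorials.\<close>

lemma has_integral_pow_mult_pow:
  "((\<lambda>x::real. x ^ a * (1 - x) ^ b) has_integral (fact a * fact b / fact (a + b + 1))) {0..1}"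
proof (rule has_integral_spike_finite)
  have "Beta (real a + 1) (real b + 1) = fact a * fact b / fact (a + b + 1)"
    using Gamma_fact[of a, where 'a=real] Gamma_fact[of b, where 'a=real]
      Gamma_fact[of "a+b+1", where 'a=real]
    by (simp add: Beta_def add_ac del: fact_Suc)
  then show "((\<lambda>x. x powr (real a + 1 - 1) * (1 - x) powr (real b + 1 - 1))
     has_integral (fact a * fact b / fact (a + b + 1))) {0..1}"
    using has_integral_Beta_real[of "real a + 1" "real b + 1"] by simp
  \<comment> \<open>The endpoints are excepted because \<open>0 powr 0 = 0\<close> whereas
    \<open>0 ^ 0 = 1\<close>, so the integrands differ there when an exponent is 0.\<close>
  show "finite {0, 1 :: real}" by simp
qed (auto simp: powr_realpow)

lemma nn_integral_Beta_nat:
  assumes "t > 0"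
  shows "(\<integral>\<^sup>+ c. indicator {0..1} c * ennreal (real t * (1 - c) ^ (t - 1)) * ennreal (c ^ s) \<partial>lborel)
    = ennreal (1 / real ((s + t) choose s))"
proof -
  have "(\<integral>\<^sup>+ c. indicator {0..1} c * ennreal (real t * (1 - c) ^ (t - 1)) * ennreal (c ^ s) \<partial>lborel)
    = (\<integral>\<^sup>+ c. ennreal (indicator {0..1} c * (real t * (c ^ s * (1 - c) ^ (t - 1)))) \<partial>lborel)"
    by (intro nn_integral_cong)
       (auto simp: indicator_def ennreal_mult'[symmetric] mult_ac)
  also have "\<dots> = ennreal (real t * (fact s * fact (t - 1) / fact (s + (t - 1) + 1)))"
    using nn_integral_has_integral_lebesgue
        [OF _ has_integral_mult_right[OF has_integral_pow_mult_pow[of s "t - 1"], of t]]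
    by simp
  \<comment> \<open>Since t > 0, the factor t turns (t - 1)! into t!, and the truncated
    \<open>s + (t - 1) + 1\<close> is s + t.\<close>
  also have "real t * (fact s * fact (t - 1) / fact (s + (t - 1) + 1)) = 1 / real ((s + t) choose s)"
    using assms by (cases t) (simp_all add: binomial_fact field_simps)
  finally show ?thesis .
qed

text \<open>An antiderivative is -(1 - c)^t, which vanishes at c = 1 because t > 0.\<close>

lemma nn_integral_deriv_power:
  assumes "0 \<le> m" "m \<le> 1" "t > 0"
  shows "(\<integral>\<^sup>+ c. indicator {m..1} c * ennreal (real t * (1 - c) ^ (t - 1)) \<partial>lborel)
    = ennreal ((1 - m) ^ t)"
proof -
  have "(\<integral>\<^sup>+ c. ennreal (real t * (1 - c) ^ (t - 1)) * indicator {m..1} c \<partial>lborel)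
    = ennreal (- ((1 - 1) ^ t) - (- ((1 - m) ^ t)))"
    using assms
    by (intro nn_integral_FTC_Icc) (auto intro!: derivative_eq_intros)
  then show ?thesis using assms by (simp add: mult.commute)
qed

lemma emeasure_cube:
  assumes "finite V" "0 \<le> c"
  shows "emeasure (Pi\<^sub>M V (\<lambda>_. lborel)) (V \<rightarrow>\<^sub>E {0..c::real}) = ennreal (c ^ card V)"
  using assms by (simp add: lborel_prod.emeasure_PiM ennreal_power)

lemma emeasure_complete_bipartite:
  fixes U V :: "'a set"
  assumes "finite U" "finite V" "U \<inter> V = {}" "U \<noteq> {}" "V \<noteq> {}"
    and P: "P = {x \<in> U \<union> V \<rightarrow>\<^sub>E {0..1::real}. \<forall>u\<in>U. \<forall>v\<in>V. x u + x v \<le> 1}"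
    and meas: "P \<in> sets (Pi\<^sub>M (U \<union> V) (\<lambda>_. lborel))"
  shows "emeasure (Pi\<^sub>M (U \<union> V) (\<lambda>_. lborel)) P
    = ennreal (1 / real ((card U + card V) choose card U))"
proof -
  let ?M = "\<lambda>I. Pi\<^sub>M I (\<lambda>_::'a. lborel :: real measure)"
  define t where "t = card V"
  \<comment> \<open>\<open>g\<close> is minus the derivative of (1 - c)^t, so its integral over
    [m, 1] is the volume of the cube of side 1 - m.\<close>
  define g where "g c = ennreal (real t * (1 - c) ^ (t - 1))" for c :: real
  have t: "t > 0" using assms by (simp add: t_def card_gt_0_iff)
  interpret U: finite_product_sigma_finite "\<lambda>_. lborel :: real measure" U by standard fact
  interpret UL: pair_sigma_finite "?M U" "lborel :: real measure" ..
  have g[measurable]: "g \<in> borel_measurable borel" unfolding g_def by measurable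
  have slice: "(\<integral>\<^sup>+ y. indicator P (merge U V (x, y)) \<partial>?M V)
      = (\<integral>\<^sup>+ c. indicator {0..1} c * g c * indicator (U \<rightarrow>\<^sub>E {0..c}) x \<partial>lborel)"
    if "x \<in> space (?M U)" for x
  proof (cases "x \<in> U \<rightarrow>\<^sub>E {0..1}")
    case True
    define m where "m = Max (x ` U)"
    have m_le: "m \<le> c \<longleftrightarrow> (\<forall>u\<in>U. x u \<le> c)" for c
      using assms by (simp add: m_def)
    have m: "0 \<le> m" "m \<le> 1"
      using True assms m_le[of m] m_le[of 1] by (force simp: PiE_iff)+
    have "merge U V (x, y) \<in> P \<longleftrightarrow> y \<in> V \<rightarrow>\<^sub>E {0..1 - m}" if "y \<in> space (?M V)" for y
    proof -
      have "y \<in> V \<rightarrow>\<^sub>E {0..1 - m} \<longleftrightarrow> (\<forall>v\<in>V. 0 \<le> y v \<and> m \<le> 1 - y v)"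
        using that by (auto simp: PiE_iff space_PiM)
      \<comment> \<open>The bound y v \<le> 1 follows from x u \<le> 1 - y v and x u \<ge> 0 for any
        u in the nonempty set U.\<close>
      also have "\<dots> \<longleftrightarrow> (\<forall>v\<in>V. y v \<in> {0..1}) \<and> (\<forall>u\<in>U. \<forall>v\<in>V. x u + y v \<le> 1)"
        using m unfolding m_le by (smt (verit) True PiE_iff \<open>U \<noteq> {}\<close> atLeastAtMost_iff ex_in_conv)
      also have "\<dots> \<longleftrightarrow> merge U V (x, y) \<in> P"
        using True that \<open>U \<inter> V = {}\<close>
        by (simp add: P PiE_iff space_PiM ball_Un)
      finally show ?thesis by simp
    qed
    then have "(\<integral>\<^sup>+ y. indicator P (merge U V (x, y)) \<partial>?M V)
      = (\<integral>\<^sup>+ y. indicator (V \<rightarrow>\<^sub>E {0..1 - m}) y \<partial>?M V)"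
      by (intro nn_integral_cong) (auto simp: indicator_def)
    also have "\<dots> = ennreal ((1 - m) ^ t)"
      using m assms
      by (subst nn_integral_indicator) (auto simp: emeasure_cube t_def intro!: sets_PiM_I_finite)
    also have "\<dots> = (\<integral>\<^sup>+ c. indicator {m..1} c * g c \<partial>lborel)"
      using nn_integral_deriv_power[OF m t] by (simp add: g_def)
    also have "\<dots> = (\<integral>\<^sup>+ c. indicator {0..1} c * g c * indicator (U \<rightarrow>\<^sub>E {0..c}) x \<partial>lborel)"
    proof (intro nn_integral_cong)
      fix c :: real
      have "x \<in> U \<rightarrow>\<^sub>E {0..c} \<longleftrightarrow> m \<le> c"
        using True by (auto simp: m_le PiE_iff)
      then show "indicator {m..1} c * g c = indicator {0..1} c * g c * indicator (U \<rightarrow>\<^sub>E {0..c}) x"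
        using m by (auto simp: indicator_def)
    qed
    finally show ?thesis .
  next
    case False
    \<comment> \<open>Outside the unit cube both sides vanish: x already violates a box constraint
      of P, and no cube [0, c]^U with c \<le> 1 contains x.\<close>
    then have "merge U V (x, y) \<notin> P" for y
      using that assms(3) by (auto simp: P PiE_iff space_PiM merge_def split: if_splits)
    moreover have "x \<notin> U \<rightarrow>\<^sub>E {0..c}" if "c \<le> 1" for c
      using that False by (force simp: PiE_iff)
    then have "(\<integral>\<^sup>+ c. indicator {0..1} c * g c * indicator (U \<rightarrow>\<^sub>E {0..c}) x \<partial>lborel)
      = (\<integral>\<^sup>+ c. 0 \<partial>(lborel :: real measure))"
      by (intro nn_integral_cong) (auto simp: indicator_def)
    ultimately show ?thesis by (simp add: indicator_def)
  qed
  \<comment> \<open>The cube varies with c, so joint measurability in (x, c) is obtained by writing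
    membership as finitely many comparisons; points of the product space are extensional
    already.\<close>
  have indicator_cube: "indicator {0..1} c * g c * indicator (U \<rightarrow>\<^sub>E {0..c}) x
    = indicator {0..1} c * g c * (if \<forall>u\<in>U. 0 \<le> x u \<and> x u \<le> c then 1 else 0)"
    if "x \<in> space (?M U)" for x and c :: real
    using that by (auto simp: indicator_def PiE_iff space_PiM)
  have [measurable]: "(\<lambda>(x, c). indicator {0..1} c * g c * indicator (U \<rightarrow>\<^sub>E {0..c}) x)
      \<in> borel_measurable (?M U \<Otimes>\<^sub>M lborel)"
  proof -
    have [measurable]: "Measurable.pred (?M U \<Otimes>\<^sub>M lborel) (\<lambda>z. \<forall>u\<in>U. 0 \<le> fst z u \<and> fst z u \<le> snd z)"
      using assms(1) by (intro pred_intros_finite) measurable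
    have "(\<lambda>z. indicator {0..1} (snd z) * g (snd z) *
        (if \<forall>u\<in>U. 0 \<le> fst z u \<and> fst z u \<le> snd z then 1 else 0))
      \<in> borel_measurable (?M U \<Otimes>\<^sub>M lborel)" by measurable
    then show ?thesis
      by (rule measurable_cong[THEN iffD1, rotated]) (auto simp: space_pair_measure indicator_cube)
  qed
  have "emeasure (?M (U \<union> V)) P = (\<integral>\<^sup>+ z. indicator P z \<partial>?M (U \<union> V))"
    using meas by simp
  also have "\<dots> = (\<integral>\<^sup>+ x. \<integral>\<^sup>+ y. indicator P (merge U V (x, y)) \<partial>?M V \<partial>?M U)"
    using meas assms by (intro lborel_prod.product_nn_integral_fold) auto
  also have "\<dots> = (\<integral>\<^sup>+ x. \<integral>\<^sup>+ c. indicator {0..1} c * g c * indicator (U \<rightarrow>\<^sub>E {0..c}) x \<partial>lborel \<partial>?M U)"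
    by (intro nn_integral_cong slice)
  \<comment> \<open>Tonelli: the integrand is nonnegative, so joint measurability suffices for the
    exchange.\<close>
  also have "\<dots> = (\<integral>\<^sup>+ c. \<integral>\<^sup>+ x. indicator {0..1} c * g c * indicator (U \<rightarrow>\<^sub>E {0..c}) x \<partial>?M U \<partial>lborel)"
    by (intro UL.Fubini'[symmetric]) measurable
  also have "\<dots> = (\<integral>\<^sup>+ c. indicator {0..1} c * g c * ennreal (c ^ card U) \<partial>lborel)"
  proof (intro nn_integral_cong)
    fix c :: real
    have "(U \<rightarrow>\<^sub>E {0..c}) \<in> sets (?M U)" using assms by (intro sets_PiM_I_finite) auto
    then have "(\<integral>\<^sup>+ x. indicator {0..1} c * g c * indicator (U \<rightarrow>\<^sub>E {0..c}) x \<partial>?M U)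
      = indicator {0..1} c * g c * emeasure (?M U) (U \<rightarrow>\<^sub>E {0..c})"
      by (simp add: nn_integral_cmult_indicator)
    \<comment> \<open>For c < 0, where \<open>emeasure_cube\<close> does not apply, the indicator of
      [0, 1] makes both sides 0.\<close>
    then show "(\<integral>\<^sup>+ x. indicator {0..1} c * g c * indicator (U \<rightarrow>\<^sub>E {0..c}) x \<partial>?M U)
      = indicator {0..1} c * g c * ennreal (c ^ card U)"
      using assms by (simp add: indicator_def emeasure_cube)
  qed
  also have "\<dots> = ennreal (1 / real ((card U + card V) choose card U))"
    using nn_integral_Beta_nat[OF t, of "card U"] by (simp add: g_def t_def)
  finally show ?thesis .
qed

theorem corollary2p7:
  fixes s t :: nat and G :: "('a, 'b) pre_digraph"
  assumes "s > 0" and "t > 0"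
    and "K\<^bsub>s,t\<^esub> G"
  shows "graph_vol G = 1 / real ((s + t) choose s)"
proof -
  from assms(3) obtain U V where "graph G" and UV: "verts G = U \<union> V" "U \<inter> V = {}"
      "card U = s" "card V = t" "arcs_ends G = U \<times> V \<union> V \<times> U"
    unfolding complete_bipartite_digraph_def by blast
  \<comment> \<open>Each edge appears as two opposite arcs, which impose the same
    inequality.\<close>
  have "graph_polytope G = {x \<in> U \<union> V \<rightarrow>\<^sub>E {0..1}. \<forall>u\<in>U. \<forall>v\<in>V. x u + x v \<le> 1}"
    by (fastforce simp: graph_polytope_def UV add.commute)
  \<comment> \<open>Positive cardinality gives both properties, since \<open>card\<close> is 0 on
    infinite sets and on the empty set.\<close>
  moreover have "finite U" "finite V" "U \<noteq> {}" "V \<noteq> {}"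
    using assms(1,2) UV by (auto intro: card_ge_0_finite)
  ultimately have "emeasure (Pi\<^sub>M (verts G) (\<lambda>_. lborel)) (graph_polytope G)
      = ennreal (1 / real ((s + t) choose s))"
    using emeasure_complete_bipartite[of U V "graph_polytope G"]
      graph_polytope_measurable[OF \<open>graph G\<close>] UV by simp
  then show ?thesis
    by (simp add: graph_vol_def measure_def)
qed

end
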